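(* Let $A=(A_{ij})_{i,j\in I}$ be a symmetrizable intersection matrix (SIM) such that $A$ is positive semi-definite and $\operatorname{corank} A\le 1$. Then for every $d\in I$ such that the submatrix $(A_{ij})_{i,j\in I\setminus\{d\}}$ is positive definite, there is a finite sequence of APR-transformations $\tau_{a_1},\dots,\tau_{a_m}$ at vertices $a_1,\dots,a_m\in I\setminus\{d\}$ such that $\tau_{a_m}\cdots\tau_{a_1}A$ is a generalized Cartan matrix. In particular $A$ is braid-equivalent to a generalized Cartan matrix.
   Context: A generalized intersection matrix is an integral matrix $A=(A_{ij})_{i,j\in I}$, $I$ a finite index set, with $A_{ii}=2$, $A_{ij}<0\Leftrightarrow A_{ji}<0$ and $A_{ij}>0\Leftrightarrow A_{ji}>0$ for all $i,j$. It is a symmetrizable intersection matrix (SIM) if there is a diagonal matrix $D=\mathrm{diag}(d_i)_{i\in I}$ with positive integers $d_i$, $\gcd(d_i)_{i\in I}=1$, such that $B=DA$ is symmetric. $A$ (or a principal submatrix) is called positive (semi-)definite if $DA$ (resp. its corresponding principal submatrix) is; $\operatorname{corank}A=|I|-\operatorname{rank}A$. A generalized Cartan matrix (GCM) is a generalized intersection matrix with $A_{ij}\le 0$ for $i\ne j$. The SIM-root basis of $A$ is a basis $\Delta=\{\alpha_i\mid i\in I\}$ of a $\mathbb Q$-vector space $H$ of dimension $|I|$ with symmetric bilinear form $(\alpha_i,\alpha_j)=B_{ij}$, so $A_{ij}=2(\alpha_i,\alpha_j)/(\alpha_i,\alpha_i)$; $A$ is called the structural matrix of $\Delta$. For non-isotropic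 $\alpha\in H$, $s_\alpha(\beta)=\beta-\frac{2(\alpha,\beta)}{(\alpha,\alpha)}\alpha$. For $a,b\in I$ the braid-transformation $\tau_{a,b}$ replaces $\Delta$ by $\Delta'=\{\alpha'_i\}$ with $\alpha'_i=\alpha_i$ for $i\ne b$ and $\alpha'_b=s_{\alpha_a}(\alpha_b)$ (the form on $H$ is unchanged); $\tau_{a,b}A$ denotes the structural matrix of $\Delta'$. Two SIMs are braid-equivalent if one is obtained from the other by a finite sequence of braid-transformations and permutations of the index set. For $a\in I$ let $N(a)=\{a\}\cup\{b\in I\mid A_{ab}<0\}$. The APR-transformation $\tau_a$ replaces $\Delta$ by $\{\alpha^a_i\}$ with $\alpha^a_i=s_{\alpha_a}(\alpha_i)$ for $i\in N(a)$ and $\alpha^a_i=\alpha_i$ for $i\notin N(a)$ (it is a composition of braid-transformations); $\tau_aA$ denotes the structural matrix of the new root basis. In a sequence of APR-transformations, each $N(a)$ is computed from the current structural matrix. *)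

theory Defs
  imports "HOL-Analysis.Analysis"
begin

text \<open>The finite index set is the universe of a type \<open>'n::finite\<close>. Integral matrices are rational
  matrices with entries in \<open>\<int>\<close>, so that a structural matrix, which is defined by quotients, has the
  same type as the matrix one starts from.\<close>

definition gen_intersection_matrix :: "rat^'n^'n \<Rightarrow> bool" where
  "gen_intersection_matrix A \<longleftrightarrow>
     (\<forall>i j. A $ i $ j \<in> \<int>) \<and>
     (\<forall>i. A $ i $ i = 2) \<and>
     (\<forall>i j. A $ i $ j < 0 \<longleftrightarrow> A $ j $ i < 0) \<and>
     (\<forall>i j. A $ i $ j > 0 \<longleftrightarrow> A $ j $ i > 0)"

definition gen_Cartan_matrix :: "rat^'n^'n \<Rightarrow> bool" where
  "gen_Cartan_matrix A \<longleftrightarrow> gen_intersection_matrix A \<and> (\<forall>i j. i \<noteq> j \<longrightarrow> A $ i $ j \<le> 0)"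

text \<open>\<open>scaled D A\<close> is the product of the diagonal matrix with entries \<open>D i\<close> and \<open>A\<close>.\<close>

definition scaled :: "('n \<Rightarrow> nat) \<Rightarrow> rat^'n^'n \<Rightarrow> rat^'n^'n" where
  "scaled D A = (\<chi> i j. of_nat (D i) * A $ i $ j)"

definition symmetrizer :: "('n::finite \<Rightarrow> nat) \<Rightarrow> rat^'n^'n \<Rightarrow> bool" where
  "symmetrizer D A \<longleftrightarrow>
     (\<forall>i. D i > 0) \<and> Gcd (range D) = 1 \<and> transpose (scaled D A) = scaled D A"

definition SIM :: "rat^'n^'n \<Rightarrow> bool" where
  "SIM A \<longleftrightarrow> gen_intersection_matrix A \<and> (\<exists>D. symmetrizer D A)"

definition positive_definite_on :: "'n set \<Rightarrow> rat^'n^'n \<Rightarrow> bool" where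
  "positive_definite_on J B \<longleftrightarrow>
     (\<forall>x :: 'n \<Rightarrow> rat. (\<exists>i\<in>J. x i \<noteq> 0) \<longrightarrow> (\<Sum>i\<in>J. \<Sum>j\<in>J. x i * B $ i $ j * x j) > 0)"

definition positive_semidefinite :: "rat^'n^'n \<Rightarrow> bool" where
  "positive_semidefinite B \<longleftrightarrow>
     (\<forall>x :: 'n \<Rightarrow> rat. (\<Sum>i\<in>UNIV. \<Sum>j\<in>UNIV. x i * B $ i $ j * x j) \<ge> 0)"

definition corank :: "rat^'n^'n \<Rightarrow> nat" where
  "corank A = CARD('n) - rank A"

text \<open>The space \<open>H\<close> is \<open>rat^'n\<close>, the SIM-root basis is its standard basis, and the form has Gram
  matrix \<open>scaled D A\<close> with respect to it.\<close>

definition root_form :: "('n::finite \<Rightarrow> nat) \<Rightarrow> rat^'n^'n \<Rightarrow> rat^'n \<Rightarrow> rat^'n \<Rightarrow> rat" where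
  "root_form D A x y = (\<Sum>i\<in>UNIV. \<Sum>j\<in>UNIV. x $ i * scaled D A $ i $ j * y $ j)"

definition root_basis :: "'n \<Rightarrow> rat^'n" where
  "root_basis i = axis i 1"

definition structural_matrix ::
    "(rat^'n \<Rightarrow> rat^'n \<Rightarrow> rat) \<Rightarrow> ('n \<Rightarrow> rat^'n) \<Rightarrow> rat^'n^'n" where
  "structural_matrix F \<Delta> = (\<chi> i j. 2 * F (\<Delta> i) (\<Delta> j) / F (\<Delta> i) (\<Delta> i))"

definition reflection :: "(rat^'n \<Rightarrow> rat^'n \<Rightarrow> rat) \<Rightarrow> rat^'n \<Rightarrow> rat^'n \<Rightarrow> rat^'n" where
  "reflection F \<alpha> \<beta> = \<beta> - (2 * F \<alpha> \<beta> / F \<alpha> \<alpha>) *s \<alpha>"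

definition braid_transform ::
    "(rat^'n \<Rightarrow> rat^'n \<Rightarrow> rat) \<Rightarrow> 'n \<Rightarrow> 'n \<Rightarrow> ('n \<Rightarrow> rat^'n) \<Rightarrow> ('n \<Rightarrow> rat^'n)" where
  "braid_transform F a b \<Delta> = \<Delta>(b := reflection F (\<Delta> a) (\<Delta> b))"

inductive braid_reachable ::
    "(rat^'n \<Rightarrow> rat^'n \<Rightarrow> rat) \<Rightarrow> ('n \<Rightarrow> rat^'n) \<Rightarrow> ('n \<Rightarrow> rat^'n) \<Rightarrow> bool"
  for F \<Delta> where
  refl: "braid_reachable F \<Delta> \<Delta>"
| braid: "braid_reachable F \<Delta> \<Delta>' \<Longrightarrow> braid_reachable F \<Delta> (braid_transform F a b \<Delta>')"
| perm: "braid_reachable F \<Delta> \<Delta>' \<Longrightarrow> bij \<sigma> \<Longrightarrow> braid_reachable F \<Delta> (\<Delta>' \<circ> \<sigma>)"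

text \<open>For decomposable \<open>A\<close> the symmetrizer is not unique, but the matrices obtained from \<open>A\<close> do not
  depend on its choice: the braid-transformation of the pair \<open>(a, b)\<close> changes \<open>A $ i $ b\<close> to
  \<open>A $ i $ b - A $ a $ b * A $ i $ a\<close> for \<open>i \<noteq> b\<close>, and similarly for row \<open>b\<close>.\<close>

definition braid_obtained :: "rat^'n^'n \<Rightarrow> rat^'n^'n \<Rightarrow> bool" where
  "braid_obtained A A' \<longleftrightarrow>
     (\<exists>D \<Delta>. symmetrizer D A \<and> braid_reachable (root_form D A) root_basis \<Delta> \<and>
            A' = structural_matrix (root_form D A) \<Delta>)"

definition braid_equivalent :: "rat^'n^'n \<Rightarrow> rat^'n^'n \<Rightarrow> bool" where
  "braid_equivalent A A' \<longleftrightarrow>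
     SIM A \<and> SIM A' \<and> (braid_obtained A A' \<or> braid_obtained A' A)"

definition APR_neighbours :: "rat^'n^'n \<Rightarrow> 'n \<Rightarrow> 'n set" where
  "APR_neighbours A a = {a} \<union> {b. A $ a $ b < 0}"

definition APR_transform ::
    "(rat^'n \<Rightarrow> rat^'n \<Rightarrow> rat) \<Rightarrow> 'n \<Rightarrow> ('n \<Rightarrow> rat^'n) \<Rightarrow> ('n \<Rightarrow> rat^'n)" where
  "APR_transform F a \<Delta> =
     (\<lambda>i. if i \<in> APR_neighbours (structural_matrix F \<Delta>) a then reflection F (\<Delta> a) (\<Delta> i) else \<Delta> i)"

text \<open>\<open>APR_sequence D A [a\<^sub>1, \<dots>, a\<^sub>m]\<close> is \<open>\<tau>\<^bsub>a\<^sub>m\<^esub> \<cdots> \<tau>\<^bsub>a\<^sub>1\<^esub> A\<close>: the head of the list acts first.\<close>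

definition APR_sequence :: "('n::finite \<Rightarrow> nat) \<Rightarrow> rat^'n^'n \<Rightarrow> 'n list \<Rightarrow> rat^'n^'n" where
  "APR_sequence D A as =
     structural_matrix (root_form D A) (fold (APR_transform (root_form D A)) as root_basis)"

lemma root_form_root_basis: "root_form D A (root_basis i) (root_basis j) = scaled D A $ i $ j"
proof -
  have "root_form D A (root_basis i) (root_basis j) =
      (\<Sum>k\<in>UNIV. \<Sum>l\<in>UNIV. if l = j then (if k = i then scaled D A $ k $ l else 0) else 0)"
    unfolding root_form_def root_basis_def by (intro sum.cong refl) (simp_all add: axis_def)
  then show ?thesis
    by simp
qed

lemma structural_matrix_root_basis:
  assumes "gen_intersection_matrix A" "symmetrizer D A"
  shows "structural_matrix (root_form D A) root_basis = A"
proof -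
  have "D i \<noteq> 0" "A $ i $ i = 2" for i
    using assms by (auto simp: gen_intersection_matrix_def symmetrizer_def)
  then show ?thesis
    by (simp add: structural_matrix_def root_form_root_basis scaled_def vec_eq_iff)
qed

end

theory Submission
  imports Defs
begin

text \<open>
Write \<open>\<alpha>\<^sub>i\<close> for the current root basis and \<open>s\<^sub>a\<close> for the reflection in \<open>\<alpha>\<^sub>a\<close>. The APR-transformation at
\<open>a\<close> is \<open>s\<^sub>a\<close> composed with a milder operation, the subtractive step, which replaces \<open>\<alpha>\<^sub>i\<close> by
\<open>s\<^sub>a \<alpha>\<^sub>i = \<alpha>\<^sub>i - A\<^bsub>ai\<^esub> \<alpha>\<^sub>a\<close> exactly when \<open>i \<noteq> a\<close> and \<open>A\<^bsub>ai\<^esub> > 0\<close>. Indeed the step does nothing where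
the APR-transformation reflects, and where the step reflects, the two reflections cancel
(\<open>APR_transform_eq_reflected_subtractive_step\<close>). Structural matrices do not see isometries, and
APR-transformations commute with them, so for the matrices that can be reached it makes no
difference whether one performs APR-transformations or subtractive steps.

A subtractive step only ever enlarges the cone of nonnegative combinations of the basis, since
\<open>\<alpha>\<^sub>i = (\<alpha>\<^sub>i - p \<alpha>\<^sub>a) + p \<alpha>\<^sub>a\<close> with \<open>p \<ge> 0\<close>, and the enlargement is strict as soon as some \<open>p\<close> is
positive (\<open>nonneg_cone_shear_psubset\<close>). Hence no basis recurs. On the other hand, steps at vertices
different from \<open>d\<close> keep the basis integral, keep the norms of its members and keep the coordinate at
the original \<open>\<alpha>\<^sub>d\<close>. As the form is semidefinite, and definite on the complement of \<open>d\<close>, only finitely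
many bases have these properties (\<open>finite_admissible\<close>). The process therefore stops, and it can only stop at a
generalized Cartan matrix: if \<open>A\<^bsub>ij\<^esub> > 0\<close> with \<open>i \<noteq> j\<close>, then also \<open>A\<^bsub>ji\<^esub> > 0\<close>, and one of \<open>i\<close>, \<open>j\<close> is not
\<open>d\<close>, so that a further strict step is available (\<open>APR_reaches_Cartan\<close>).

For the braid-equivalence one needs some vertex \<open>d\<close> with definite complement. In a semidefinite
form the isotropic vectors form the radical, whose dimension here is at most one; any \<open>d\<close> in the
support of a generator will do (\<open>exists_vertex_with_definite_complement\<close>).
\<close>

section \<open>Symmetric bilinear forms\<close>

locale symmetric_form =
  fixes F :: "rat^'n::finite \<Rightarrow> rat^'n \<Rightarrow> rat"
  assumes sym: "F x y = F y x"
    and add_left: "F (x + y) z = F x z + F y z"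
    and scale_left: "F (c *s x) y = c * F x y"
begin

lemma add_right: "F z (x + y) = F z x + F z y"
  using add_left sym by metis

lemma scale_right: "F y (c *s x) = c * F y x"
  using scale_left sym by metis

lemma diff_left: "F (x - y) z = F x z - F y z"
  using add_left[of "x - y" y z] by simp

lemma diff_right: "F z (x - y) = F z x - F z y"
  using diff_left sym by metis

lemma zero_left: "F 0 y = 0"
  using diff_left[of 0 0 y] by simp

lemmas form_simps = add_left add_right scale_left scale_right diff_left diff_right

lemma reflection_preserves_form:
  assumes "F \<alpha> \<alpha> \<noteq> 0"
  shows "F (reflection F \<alpha> x) (reflection F \<alpha> y) = F x y"
  using assms by (simp add: reflection_def form_simps sym[of x \<alpha>] sym[of y \<alpha>] field_simps)

lemma reflection_self_adjoint:
  assumes "F \<alpha> \<alpha> \<noteq> 0"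
  shows "F (reflection F \<alpha> x) y = F x (reflection F \<alpha> y)"
  using assms by (simp add: reflection_def form_simps sym[of x \<alpha>] sym[of y \<alpha>] field_simps)

lemma reflection_involution:
  assumes "F \<alpha> \<alpha> \<noteq> 0"
  shows "reflection F \<alpha> (reflection F \<alpha> x) = x"
  using assms by (simp add: reflection_def form_simps field_simps vec_eq_iff)

text \<open>The minimum of \<open>t \<mapsto> F (v - t u) (v - t u)\<close> is attained at \<open>t = F u v / F u u\<close>.\<close>

lemma Cauchy_Schwarz_form:
  assumes pos: "\<And>x. x \<noteq> 0 \<Longrightarrow> F x x > 0"
  shows "(F u v)\<^sup>2 \<le> F u u * F v v"
proof (cases "u = 0")
  case True
  then show ?thesis by (simp add: zero_left)
next
  case False
  then have c: "F u u > 0" by (rule pos)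
  have "0 \<le> F (v - (F u v / F u u) *s u) (v - (F u v / F u u) *s u)"
    using pos zero_left by (metis order.refl less_imp_le)
  also have "\<dots> = F v v - (F u v)\<^sup>2 / F u u"
    using c by (simp add: form_simps sym[of v u] field_simps power2_eq_square)
  finally show ?thesis
    using c by (simp add: field_simps)
qed

text \<open>A vector of length zero minimises the quadratic form, so the form has derivative zero there.\<close>

lemma isotropic_in_radical:
  assumes psd: "\<And>x. F x x \<ge> 0" and x: "F x x = 0"
  shows "F x y = 0"
proof (rule ccontr)
  assume ne: "F x y \<noteq> 0"
  define s where "s = - (F y y + 1) / (2 * F x y)"
  have "0 \<le> F (y + s *s x) (y + s *s x)"
    by (rule psd)
  also have "\<dots> = F y y + 2 * s * F x y"
    using x by (simp add: form_simps sym[of y x])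
  also have "\<dots> = -1"
    using ne by (simp add: s_def field_simps)
  finally show False by simp
qed

end

section \<open>Integral vectors of given norm in a definite form\<close>

lemma finite_bounded_integral_vectors:
  fixes b :: "'n::finite \<Rightarrow> rat"
  shows "finite {v :: rat^'n. \<forall>i. v $ i \<in> \<int> \<and> \<bar>v $ i\<bar> \<le> b i}"
proof -
  define I where "I i = (of_int :: int \<Rightarrow> rat) ` {- \<lfloor>b i\<rfloor>..\<lfloor>b i\<rfloor>}" for i
  have "{v :: rat^'n. \<forall>i. v $ i \<in> \<int> \<and> \<bar>v $ i\<bar> \<le> b i} \<subseteq> vec_lambda ` (PiE UNIV I)"
  proof
    fix v :: "rat^'n"
    assume v: "v \<in> {v. \<forall>i. v $ i \<in> \<int> \<and> \<bar>v $ i\<bar> \<le> b i}"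
    have "v $ i \<in> I i" for i
    proof -
      obtain k where k: "v $ i = of_int k"
        using v by (auto elim: Ints_cases)
      then have "\<bar>k\<bar> \<le> \<lfloor>b i\<rfloor>"
        using v by (auto simp: le_floor_iff dest!: spec[of _ i])
      then have "k \<in> {- \<lfloor>b i\<rfloor>..\<lfloor>b i\<rfloor>}"
        by auto
      then show ?thesis
        by (auto simp: I_def k)
    qed
    then have "vec_nth v \<in> PiE UNIV I"
      by (auto simp: PiE_def)
    then show "v \<in> vec_lambda ` (PiE UNIV I)"
      by (metis image_eqI vec_nth_inverse)
  qed
  moreover have "finite (PiE UNIV I)"
    by (intro finite_PiE) (auto simp: I_def)
  ultimately show ?thesis
    by (meson finite_imageI finite_subset)
qed

context symmetric_form
begin

definition gram :: "rat^'n^'n" where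
  "gram = (\<chi> i j. F (axis i 1) (axis j 1))"

lemma form_sum_left: "F (\<Sum>i\<in>S. f i) y = (\<Sum>i\<in>S. F (f i) y)"
  by (induction S rule: infinite_finite_induct) (auto simp: add_left zero_left)

lemma gram_apply: "(gram *v x) $ i = F (axis i 1) x"
proof -
  have "F (axis i 1) x = F (\<Sum>j\<in>UNIV. x $ j *s axis j 1) (axis i 1)"
    by (simp add: basis_expansion sym[of x])
  then show ?thesis
    by (simp add: form_sum_left scale_left gram_def matrix_vector_mult_def sym[of "axis i 1"]
        mult.commute)
qed

text \<open>A definite form is nondegenerate, so each coordinate functional is the pairing with some vector.\<close>

lemma coordinate_represented:
  assumes pos: "\<And>x. x \<noteq> 0 \<Longrightarrow> F x x > 0"
  shows "\<exists>u. \<forall>v. F u v = v $ i"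
proof -
  have "x = 0" if "gram *v x = 0" for x
  proof -
    have "F x x = F (\<Sum>j\<in>UNIV. x $ j *s axis j 1) x"
      by (simp add: basis_expansion)
    also have "\<dots> = (\<Sum>j\<in>UNIV. x $ j * (gram *v x) $ j)"
      by (simp add: form_sum_left scale_left gram_apply)
    also have "\<dots> = 0"
      by (simp add: that)
    finally show ?thesis
      using pos[of x] by fastforce
  qed
  then obtain B where "B ** gram = mat 1"
    using matrix_left_invertible_ker[of gram] by auto
  then have "gram ** B = mat 1"
    by (simp add: matrix_left_right_inverse)
  then have B: "gram *v (B *v axis i 1) = axis i 1"
    by (simp add: matrix_vector_mul_assoc)
  have "F (B *v axis i 1) v = v $ i" for v
  proof -
    have "F (B *v axis i 1) v = F (\<Sum>j\<in>UNIV. v $ j *s axis j 1) (B *v axis i 1)"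
      by (simp add: basis_expansion sym[of v])
    also have "\<dots> = (\<Sum>j\<in>UNIV. v $ j * (axis i 1 :: rat^'n) $ j)"
      by (simp add: form_sum_left scale_left B flip: gram_apply)
    also have "\<dots> = v $ i"
      by (simp add: axis_def if_distrib cong: if_cong)
    finally show ?thesis .
  qed
  then show ?thesis by blast
qed

text \<open>With the coordinate functionals written as pairings, the Cauchy-Schwarz inequality bounds every
  coordinate in terms of the norm. A compactness argument would have to pass to the reals.\<close>

lemma finite_integral_vectors_of_norm:
  assumes pos: "\<And>x. x \<noteq> 0 \<Longrightarrow> F x x > 0"
  shows "finite {v. (\<forall>i. v $ i \<in> \<int>) \<and> F v v = m}"
proof -
  have "\<exists>u. \<forall>v. F u v = v $ i" for i
    using pos by (rule coordinate_represented)
  then obtain u where u: "F (u i) v = v $ i" for i v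
    by metis
  \<comment> \<open>The summand 1 avoids a square root: \<open>t \<le> t\<^sup>2 + 1\<close>.\<close>
  have "\<bar>v $ i\<bar> \<le> F (u i) (u i) * m + 1" if "F v v = m" for v i
  proof -
    have "(F (u i) v)\<^sup>2 \<le> F (u i) (u i) * F v v"
      using pos by (rule Cauchy_Schwarz_form)
    then have "(v $ i)\<^sup>2 \<le> F (u i) (u i) * m"
      using that by (simp only: u[of i v])
    moreover have "\<bar>v $ i\<bar> \<le> (v $ i)\<^sup>2 + 1"
    proof -
      have "0 \<le> (\<bar>v $ i\<bar> - 1)\<^sup>2" by simp
      then have "2 * \<bar>v $ i\<bar> \<le> (v $ i)\<^sup>2 + 1"
        by (simp add: power2_diff)
      then show ?thesis by linarith
    qed
    ultimately show ?thesis by linarith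
  qed
  then show ?thesis
    by (intro finite_subset[OF _
          finite_bounded_integral_vectors[of "\<lambda>i. F (u i) (u i) * m + 1"]]) auto
qed

end

section \<open>APR-transformations up to isometry\<close>

text \<open>This is the APR-transformation at \<open>a\<close> followed by the reflection in the old \<open>\<Delta> a\<close>.\<close>

definition subtractive_step ::
    "(rat^'n \<Rightarrow> rat^'n \<Rightarrow> rat) \<Rightarrow> 'n \<Rightarrow> ('n \<Rightarrow> rat^'n) \<Rightarrow> ('n \<Rightarrow> rat^'n)" where
  "subtractive_step F a \<Delta> =
     (\<lambda>i. if i \<noteq> a \<and> structural_matrix F \<Delta> $ a $ i > 0 then reflection F (\<Delta> a) (\<Delta> i) else \<Delta> i)"

text \<open>Compatibility with differences and scalars is the part of linearity that reflections use.\<close>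

definition linear_isometry ::
    "(rat^'n \<Rightarrow> rat^'n \<Rightarrow> rat) \<Rightarrow> (rat^'n \<Rightarrow> rat^'n) \<Rightarrow> bool" where
  "linear_isometry F w \<longleftrightarrow>
     (\<forall>x y. w (x - y) = w x - w y) \<and> (\<forall>c x. w (c *s x) = c *s w x) \<and> (\<forall>x y. F (w x) (w y) = F x y)"

lemma structural_matrix_isometry:
  "linear_isometry F w \<Longrightarrow> structural_matrix F (w \<circ> \<Delta>) = structural_matrix F \<Delta>"
  by (simp add: linear_isometry_def structural_matrix_def)

lemma APR_transform_isometry:
  assumes "linear_isometry F w"
  shows "APR_transform F a (w \<circ> \<Delta>) = w \<circ> APR_transform F a \<Delta>"
  unfolding APR_transform_def structural_matrix_isometry[OF assms]
  using assms by (auto simp: linear_isometry_def reflection_def)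

lemma fold_APR_transform_isometry:
  assumes "linear_isometry F w"
  shows "fold (APR_transform F) as (w \<circ> \<Delta>) = w \<circ> fold (APR_transform F) as \<Delta>"
  by (induction as arbitrary: \<Delta>) (simp_all add: APR_transform_isometry[OF assms])

context symmetric_form
begin

lemma linear_isometry_reflection:
  assumes "F \<alpha> \<alpha> \<noteq> 0"
  shows "linear_isometry F (reflection F \<alpha>)"
  unfolding linear_isometry_def
proof (intro conjI allI)
  show "F (reflection F \<alpha> x) (reflection F \<alpha> y) = F x y" for x y
    by (rule reflection_preserves_form[OF assms])
qed (simp_all add: reflection_def form_simps vec_eq_iff field_simps diff_divide_distrib)

text \<open>For \<open>i = a\<close> both sides are \<open>- \<Delta> a\<close>. Elsewhere the sign of the entry \<open>(a, i)\<close> decides: a negative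
  one means that only the outer reflection acts, a positive one that two reflections cancel, and
  for a zero entry the reflection fixes \<open>\<Delta> i\<close>.\<close>

lemma APR_transform_eq_reflected_subtractive_step:
  assumes "F (\<Delta> a) (\<Delta> a) \<noteq> 0"
  shows "APR_transform F a \<Delta> = reflection F (\<Delta> a) \<circ> subtractive_step F a \<Delta>"
proof
  fix i
  have orth: "reflection F (\<Delta> a) (\<Delta> i) = \<Delta> i" if "structural_matrix F \<Delta> $ a $ i = 0"
    using that assms by (simp add: structural_matrix_def reflection_def)
  have "structural_matrix F \<Delta> $ a $ a = 2"
    using assms by (simp add: structural_matrix_def)
  then show "APR_transform F a \<Delta> i = (reflection F (\<Delta> a) \<circ> subtractive_step F a \<Delta>) i"
    using orth
    by (auto simp: APR_transform_def APR_neighbours_def subtractive_step_def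
        reflection_involution[OF assms])
qed

end

section \<open>Growth of the nonnegative cone\<close>

definition nonneg_cone :: "('n::finite \<Rightarrow> rat^'n) \<Rightarrow> (rat^'n) set" where
  "nonneg_cone \<Delta> = {(\<Sum>i\<in>UNIV. x i *s \<Delta> i) | x. \<forall>i. x i \<ge> 0}"

text \<open>Linear independence of the family rather than of its range, so that repetitions are excluded.\<close>

definition independent_family :: "('n::finite \<Rightarrow> rat^'n) \<Rightarrow> bool" where
  "independent_family \<Delta> \<longleftrightarrow> (\<forall>x. (\<Sum>i\<in>UNIV. x i *s \<Delta> i) = 0 \<longrightarrow> (\<forall>i. x i = 0))"

lemma sum_single:
  fixes \<Delta> :: "'n::finite \<Rightarrow> rat^'n"
  shows "(\<Sum>i\<in>UNIV. (if i = a then c else 0) *s \<Delta> i) = c *s \<Delta> a"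
proof -
  have "(\<Sum>i\<in>UNIV. (if i = a then c else 0) *s \<Delta> i) = (\<Sum>i\<in>UNIV. if i = a then c *s \<Delta> i else 0)"
    by (intro sum.cong) auto
  then show ?thesis by simp
qed

text \<open>A subtractive step is the elementary substitution \<open>\<Delta> i \<mapsto> \<Delta> i - p i *s \<Delta> a\<close> with \<open>p \<ge> 0\<close>;
  the new coordinates of a vector arise from the old ones by adding \<open>\<Sum>i. p i * x i\<close> to the
  one at \<open>a\<close>.\<close>

lemma shear_combination:
  fixes \<Delta> :: "'n::finite \<Rightarrow> rat^'n"
  assumes "p a = 0"
  shows "(\<Sum>i\<in>UNIV. x i *s \<Delta> i) =
    (\<Sum>i\<in>UNIV. (x i + (if i = a then \<Sum>j\<in>UNIV. p j * x j else 0)) *s (\<Delta> i - p i *s \<Delta> a))"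
proof -
  have "(\<Sum>i\<in>UNIV. (x i + (if i = a then \<Sum>j\<in>UNIV. p j * x j else 0)) *s (\<Delta> i - p i *s \<Delta> a))
     = (\<Sum>i\<in>UNIV. x i *s \<Delta> i - (p i * x i) *s \<Delta> a
          + (if i = a then \<Sum>j\<in>UNIV. p j * x j else 0) *s \<Delta> i)"
    using assms by (intro sum.cong) (auto simp: vec_eq_iff algebra_simps)
  also have "\<dots> = (\<Sum>i\<in>UNIV. x i *s \<Delta> i) - (\<Sum>i\<in>UNIV. (p i * x i) *s \<Delta> a)
      + (\<Sum>j\<in>UNIV. p j * x j) *s \<Delta> a"
    by (simp only: sum.distrib sum_subtractf sum_single)
  also have "(\<Sum>i\<in>UNIV. (p i * x i) *s \<Delta> a) = (\<Sum>j\<in>UNIV. p j * x j) *s \<Delta> a"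
    by (rule vec.scale_sum_left[symmetric])
  finally show ?thesis by simp
qed

text \<open>The coordinate change of \<open>shear_combination\<close> is inverted by subtracting the same sum, because
  \<open>p a = 0\<close> makes that sum insensitive to the coordinate at \<open>a\<close>.\<close>

lemma independent_family_shear:
  assumes ind: "independent_family \<Delta>" and pa: "p a = 0"
  shows "independent_family (\<lambda>i. \<Delta> i - p i *s \<Delta> a)"
  unfolding independent_family_def
proof (intro allI impI)
  fix x i
  assume 0: "(\<Sum>i\<in>UNIV. x i *s (\<Delta> i - p i *s \<Delta> a)) = 0"
  define y where "y i = x i - (if i = a then \<Sum>j\<in>UNIV. p j * x j else 0)" for i
  have "p j * y j = p j * x j" for j
    using pa by (simp add: y_def)
  then have "(\<Sum>j\<in>UNIV. p j * y j) = (\<Sum>j\<in>UNIV. p j * x j)"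
    by (simp only:)
  then have x: "x i = y i + (if i = a then \<Sum>j\<in>UNIV. p j * y j else 0)" for i
    using y_def[of i] by simp
  have "(\<Sum>i\<in>UNIV. y i *s \<Delta> i) = 0"
    using shear_combination[of p a y \<Delta>] pa 0 by (simp flip: x)
  then have "y j = 0" for j
    using ind by (auto simp: independent_family_def)
  then show "x i = 0"
    using x by simp
qed

text \<open>The inclusion is the nonnegativity of the new coordinates. It is strict because the new basis
  vector \<open>\<Delta> b - p b *s \<Delta> a\<close> has a negative coordinate at \<open>a\<close> in the old basis.\<close>

lemma nonneg_cone_shear_psubset:
  fixes \<Delta> :: "'n::finite \<Rightarrow> rat^'n"
  assumes ind: "independent_family \<Delta>"
    and p: "\<And>i. p i \<ge> 0" and pa: "p a = 0" and pb: "p b > 0"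
  shows "nonneg_cone \<Delta> \<subset> nonneg_cone (\<lambda>i. \<Delta> i - p i *s \<Delta> a)"
proof
  show "nonneg_cone \<Delta> \<subseteq> nonneg_cone (\<lambda>i. \<Delta> i - p i *s \<Delta> a)"
  proof
    fix v
    assume "v \<in> nonneg_cone \<Delta>"
    then obtain x where x: "v = (\<Sum>i\<in>UNIV. x i *s \<Delta> i)" "\<And>i. x i \<ge> 0"
      by (auto simp: nonneg_cone_def)
    then have "x i + (if i = a then \<Sum>j\<in>UNIV. p j * x j else 0) \<ge> 0" for i
      using p by (simp add: sum_nonneg)
    then show "v \<in> nonneg_cone (\<lambda>i. \<Delta> i - p i *s \<Delta> a)"
      unfolding nonneg_cone_def mem_Collect_eq
      by (intro exI[of _ "\<lambda>i. x i + (if i = a then \<Sum>j\<in>UNIV. p j * x j else 0)"])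
        (use x(1) shear_combination[of p a x \<Delta>, OF pa] in simp)
  qed
  have "\<Delta> b - p b *s \<Delta> a = (\<Sum>i\<in>UNIV. (if i = b then 1 else 0) *s (\<Delta> i - p i *s \<Delta> a))"
    by (subst sum_single) simp
  then have "\<Delta> b - p b *s \<Delta> a \<in> nonneg_cone (\<lambda>i. \<Delta> i - p i *s \<Delta> a)"
    by (force simp: nonneg_cone_def)
  moreover have "\<Delta> b - p b *s \<Delta> a \<notin> nonneg_cone \<Delta>"
  proof
    assume "\<Delta> b - p b *s \<Delta> a \<in> nonneg_cone \<Delta>"
    then obtain x where x: "\<Delta> b - p b *s \<Delta> a = (\<Sum>i\<in>UNIV. x i *s \<Delta> i)" "\<And>i. x i \<ge> 0"
      by (auto simp: nonneg_cone_def)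
    have "(\<Sum>i\<in>UNIV. (x i - (if i = b then 1 else 0) + (if i = a then p b else 0)) *s \<Delta> i)
        = (\<Sum>i\<in>UNIV. x i *s \<Delta> i - (if i = b then 1 else 0) *s \<Delta> i + (if i = a then p b else 0) *s \<Delta> i)"
      by (intro sum.cong) (auto simp: vec_eq_iff algebra_simps)
    also have "\<dots> = 0"
      by (simp only: sum.distrib sum_subtractf sum_single flip: x(1)) simp
    finally have "x i - (if i = b then 1 else 0) + (if i = a then p b else 0) = 0" for i
      using ind[unfolded independent_family_def, rule_format,
          of "\<lambda>i. x i - (if i = b then 1 else 0) + (if i = a then p b else 0)"] by blast
    from this[of a] have "x a - (if a = b then 1 else 0) + p b = 0"
      by simp
    moreover have "a \<noteq> b"
      using pa pb by auto
    ultimately show False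
      using x(2)[of a] pb by simp
  qed
  ultimately show "nonneg_cone \<Delta> \<noteq> nonneg_cone (\<lambda>i. \<Delta> i - p i *s \<Delta> a)"
    by blast
qed

section \<open>Termination\<close>

text \<open>These conditions survive subtractive steps away from \<open>d\<close> and leave only finitely many
  possibilities for \<open>\<Delta>\<close>.\<close>

definition admissible ::
    "(rat^'n \<Rightarrow> rat^'n \<Rightarrow> rat) \<Rightarrow> ('n \<Rightarrow> rat) \<Rightarrow> 'n \<Rightarrow> ('n::finite \<Rightarrow> rat^'n) \<Rightarrow> bool" where
  "admissible F m d \<Delta> \<longleftrightarrow>
     (\<forall>i. F (\<Delta> i) (\<Delta> i) = m i) \<and>
     (\<forall>i j. structural_matrix F \<Delta> $ i $ j \<in> \<int>) \<and>
     (\<forall>i j. \<Delta> i $ j \<in> \<int>) \<and>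
     (\<forall>i. \<Delta> i $ d = (if i = d then 1 else 0)) \<and>
     independent_family \<Delta>"

lemma subtractive_step_shear:
  "subtractive_step F a \<Delta> =
     (\<lambda>i. \<Delta> i - (if i \<noteq> a then max 0 (structural_matrix F \<Delta> $ a $ i) else 0) *s \<Delta> a)"
  by (auto simp: subtractive_step_def reflection_def structural_matrix_def max_def)

context symmetric_form
begin

text \<open>Reflections preserve norms, and the multiples of \<open>\<Delta> a\<close> being subtracted are entries of the old
  structural matrix, hence integers. As \<open>\<Delta> a\<close> has coordinate 0 at \<open>d\<close>, nothing changes there. The
  integrality of the new structural matrix is an explicit computation.\<close>

lemma admissible_subtractive_step:
  assumes adm: "admissible F m d \<Delta>" and m: "\<And>i. m i > 0" and "a \<noteq> d"
  shows "admissible F m d (subtractive_step F a \<Delta>)"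
proof -
  let ?M = "structural_matrix F \<Delta>" and ?\<Gamma> = "subtractive_step F a \<Delta>"
  define p where "p i = (if i \<noteq> a then max 0 (?M $ a $ i) else 0)" for i
  have \<Gamma>: "?\<Gamma> = (\<lambda>i. \<Delta> i - p i *s \<Delta> a)"
    unfolding p_def by (rule subtractive_step_shear)
  have norm: "F (\<Delta> i) (\<Delta> i) = m i" and int: "?M $ i $ j \<in> \<int>" "\<Delta> i $ j \<in> \<int>"
    and dcoord: "\<Delta> i $ d = (if i = d then 1 else 0)" for i j
    using adm by (auto simp: admissible_def)
  have ind: "independent_family \<Delta>"
    using adm by (simp add: admissible_def)
  have nz: "F (\<Delta> i) (\<Delta> i) \<noteq> 0" for i
    using m[of i] by (simp add: norm)
  let ?s = "reflection F (\<Delta> a)"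
  have norm': "F (?\<Gamma> i) (?\<Gamma> i) = m i" for i
    using reflection_preserves_form[OF nz] by (auto simp: subtractive_step_def norm)
  have M: "?M $ i $ j = 2 * F (\<Delta> i) (\<Delta> j) / m i" for i j
    by (simp add: structural_matrix_def norm)
  \<comment> \<open>Reflecting both vectors leaves the entry unchanged; reflecting either one gives the same value.\<close>
  have one: "2 * F (\<Delta> i) (?s (\<Delta> j)) / m i = ?M $ i $ j - ?M $ i $ a * ?M $ a $ j" for i j
    by (simp add: M reflection_def form_simps norm diff_divide_distrib algebra_simps)
  have "structural_matrix F ?\<Gamma> $ i $ j \<in> {?M $ i $ j, ?M $ i $ j - ?M $ i $ a * ?M $ a $ j}" for i j
  proof -
    have "structural_matrix F ?\<Gamma> $ i $ j = 2 * F (?\<Gamma> i) (?\<Gamma> j) / m i"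
      by (simp add: structural_matrix_def norm')
    moreover have "F (?\<Gamma> i) (?\<Gamma> j) \<in> {F (\<Delta> i) (\<Delta> j), F (\<Delta> i) (?s (\<Delta> j))}"
      using reflection_preserves_form[OF nz[of a]] reflection_self_adjoint[OF nz[of a]]
      by (auto simp: subtractive_step_def)
    ultimately show ?thesis
      using one M by auto
  qed
  then have "structural_matrix F ?\<Gamma> $ i $ j \<in> \<int>" for i j
    using int by (metis Ints_diff Ints_mult empty_iff insert_iff)
  moreover have "?\<Gamma> i $ j \<in> \<int>" for i j
    using int by (auto simp: \<Gamma> p_def max_def)
  moreover have "?\<Gamma> i $ d = (if i = d then 1 else 0)" for i
    using \<open>a \<noteq> d\<close> by (auto simp: \<Gamma> dcoord)
  moreover have "independent_family ?\<Gamma>"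
    unfolding \<Gamma> using ind by (rule independent_family_shear) (simp add: p_def)
  ultimately show ?thesis
    using norm' by (auto simp: admissible_def)
qed

text \<open>Adding the square of the coordinate at \<open>d\<close> turns the semidefinite form into a definite one. Since
  admissibility fixes that coordinate, it also fixes the norms in the new form.\<close>

lemma finite_admissible:
  assumes psd: "\<And>x. F x x \<ge> 0"
    and pd: "\<And>x. x \<noteq> 0 \<Longrightarrow> x $ d = 0 \<Longrightarrow> F x x > 0"
  shows "finite {\<Delta>. admissible F m d \<Delta>}"
proof -
  define G where "G x y = F x y + x $ d * y $ d" for x y
  interpret G: symmetric_form G
    by unfold_locales (simp_all add: G_def form_simps sym algebra_simps)
  have "G x x > 0" if "x \<noteq> 0" for x
  proof (cases "x $ d = 0")
    case True
    then show ?thesis using pd that by (simp add: G_def)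
  next
    case False
    then have "x $ d * x $ d > 0"
      by (simp add: zero_less_mult_iff) linarith
    then show ?thesis using psd[of x] by (simp add: G_def)
  qed
  note fin = G.finite_integral_vectors_of_norm[OF this]
  let ?V = "\<lambda>i. {v. (\<forall>j. v $ j \<in> \<int>) \<and> G v v = m i + (if i = d then 1 else 0)}"
  have "{\<Delta>. admissible F m d \<Delta>} \<subseteq> PiE UNIV ?V"
    by (auto simp: admissible_def G_def)
  moreover have "finite (PiE UNIV ?V)"
    by (intro finite_PiE fin) auto
  ultimately show ?thesis
    by (rule finite_subset)
qed

text \<open>The entries \<open>(i, j)\<close> and \<open>(j, i)\<close> both have the sign of \<open>F (\<Delta> i) (\<Delta> j)\<close>.\<close>

lemma gen_intersection_structural_matrix:
  assumes adm: "admissible F m d \<Delta>" and m: "\<And>i. m i > 0"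
  shows "gen_intersection_matrix (structural_matrix F \<Delta>)"
proof -
  have norm: "F (\<Delta> i) (\<Delta> i) = m i" and int: "structural_matrix F \<Delta> $ i $ j \<in> \<int>" for i j
    using adm by (auto simp: admissible_def)
  have M: "structural_matrix F \<Delta> $ i $ j = 2 * F (\<Delta> i) (\<Delta> j) / m i" for i j
    by (simp add: structural_matrix_def norm)
  have "m i \<noteq> 0" for i using m[of i] by simp
  then have "structural_matrix F \<Delta> $ i $ i = 2" for i
    by (simp add: M norm)
  moreover have "structural_matrix F \<Delta> $ i $ j < 0 \<longleftrightarrow> F (\<Delta> i) (\<Delta> j) < 0"
    and "structural_matrix F \<Delta> $ i $ j > 0 \<longleftrightarrow> F (\<Delta> i) (\<Delta> j) > 0" for i j
    using m[of i] by (simp_all only: M) (simp_all add: divide_less_0_iff zero_less_divide_iff)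
  moreover have "F (\<Delta> i) (\<Delta> j) = F (\<Delta> j) (\<Delta> i)" for i j
    by (rule sym)
  ultimately show ?thesis
    unfolding gen_intersection_matrix_def using int by metis
qed

text \<open>The induction is on the number of admissible families with a strictly larger cone.\<close>

lemma APR_reaches_Cartan:
  assumes psd: "\<And>x. F x x \<ge> 0"
    and pd: "\<And>x. x \<noteq> 0 \<Longrightarrow> x $ d = 0 \<Longrightarrow> F x x > 0"
    and m: "\<And>i. m i > 0"
    and adm: "admissible F m d \<Delta>"
  shows "\<exists>as. set as \<subseteq> UNIV - {d} \<and>
    gen_Cartan_matrix (structural_matrix F (fold (APR_transform F) as \<Delta>))"
  using adm
proof (induction "card {\<Delta>'. admissible F m d \<Delta>' \<and> nonneg_cone \<Delta> \<subset> nonneg_cone \<Delta>'}"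
    arbitrary: \<Delta> rule: less_induct)
  case less
  let ?M = "structural_matrix F \<Delta>"
  have gim: "gen_intersection_matrix ?M"
    using gen_intersection_structural_matrix less.prems m .
  show ?case
  proof (cases "gen_Cartan_matrix ?M")
    case True
    then show ?thesis by (intro exI[of _ "[]"]) simp
  next
    case False
    then obtain i j where "i \<noteq> j" "?M $ i $ j > 0" "?M $ j $ i > 0"
      using gim by (force simp: gen_Cartan_matrix_def gen_intersection_matrix_def not_le)
    \<comment> \<open>By symmetry, the vertex of the pair at which the step is made can be chosen different from \<open>d\<close>.\<close>
    then obtain a b where ab: "a \<noteq> d" "a \<noteq> b" "?M $ a $ b > 0"
      by metis
    let ?\<Gamma> = "subtractive_step F a \<Delta>"
    have adm': "admissible F m d ?\<Gamma>"
      using admissible_subtractive_step less.prems m ab(1) .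
    have ind: "independent_family \<Delta>" and nz: "F (\<Delta> a) (\<Delta> a) \<noteq> 0"
      using less.prems m[of a] by (auto simp: admissible_def)
    have "nonneg_cone \<Delta> \<subset> nonneg_cone ?\<Gamma>"
      unfolding subtractive_step_shear
      using ab by (intro nonneg_cone_shear_psubset[OF ind, where b = b]) auto
    then have "{\<Delta>'. admissible F m d \<Delta>' \<and> nonneg_cone ?\<Gamma> \<subset> nonneg_cone \<Delta>'}
        \<subset> {\<Delta>'. admissible F m d \<Delta>' \<and> nonneg_cone \<Delta> \<subset> nonneg_cone \<Delta>'}"
      using adm' by auto
    then obtain as where as: "set as \<subseteq> UNIV - {d}"
      "gen_Cartan_matrix (structural_matrix F (fold (APR_transform F) as ?\<Gamma>))"
      using less.hyps[OF psubset_card_mono adm'] finite_admissible[OF psd pd] by auto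
    have "fold (APR_transform F) (a # as) \<Delta> =
        reflection F (\<Delta> a) \<circ> fold (APR_transform F) as ?\<Gamma>"
      by (simp add: APR_transform_eq_reflected_subtractive_step[of \<Delta> a, OF nz]
          fold_APR_transform_isometry[OF linear_isometry_reflection[OF nz]])
    then have "gen_Cartan_matrix (structural_matrix F (fold (APR_transform F) (a # as) \<Delta>))"
      using as(2) structural_matrix_isometry[OF linear_isometry_reflection[OF nz]] by metis
    then show ?thesis
      using as(1) ab(1) by (intro exI[of _ "a # as"]) auto
  qed
qed

end

section \<open>A vertex with definite complement\<close>

text \<open>The rows of \<open>A\<close> are orthogonal to \<open>x\<close> and to \<open>z\<close>. If \<open>x\<close> were nonzero, these two conditions would
  cut down the dimension twice: the basis vector at \<open>d\<close> satisfies the first but not the second.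
  The rank would then be at most \<open>CARD('n) - 2\<close>.\<close>

lemma kernel_vector_determined_by_coordinate:
  fixes A :: "rat^'n^'n"
  assumes corank: "corank A \<le> 1"
    and z: "A *v z = 0" "z $ d \<noteq> 0"
    and x: "A *v x = 0" "x $ d = 0"
  shows "x = 0"
proof (rule ccontr)
  assume "x \<noteq> 0"
  define perp where "perp v = {y :: rat^'n. (\<Sum>i\<in>UNIV. y $ i * v $ i) = 0}" for v
  have sub: "vec.subspace (perp v)" for v
    by (auto simp: perp_def vec.subspace_def algebra_simps sum.distrib simp flip: sum_distrib_left)
  have axis_perp: "axis i 1 \<in> perp v \<longleftrightarrow> v $ i = 0" for v :: "rat^'n" and i
    by (simp add: perp_def axis_def if_distrib cong: if_cong)
      (simp add: if_distribR cong: if_cong)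
  have rows: "rows A \<subseteq> perp v" if "A *v v = 0" for v
    using that by (auto simp: rows_def row_def perp_def matrix_vector_mult_def vec_eq_iff)
  have sub2: "vec.subspace (perp x \<inter> perp z)"
    by (intro vec.subspace_inter sub)
  have "axis d 1 \<in> perp x" "axis d 1 \<notin> perp z"
    using x z by (auto simp: axis_perp)
  then have "perp x \<inter> perp z \<subset> perp x"
    by blast
  then have "vec.span (perp x \<inter> perp z) \<subset> vec.span (perp x)"
    using sub sub2 by (simp add: vec.span_eq_iff[THEN iffD2])
  then have 1: "vec.dim (perp x \<inter> perp z) < vec.dim (perp x)"
    by (rule vec.dim_psubset)
  obtain i where "x $ i \<noteq> 0"
    using \<open>x \<noteq> 0\<close> by (auto simp: vec_eq_iff)
  then have "perp x \<subset> UNIV"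
    using axis_perp by blast
  then have "vec.span (perp x) \<subset> vec.span (UNIV :: (rat^'n) set)"
    using sub by (simp add: vec.span_eq_iff[THEN iffD2])
  then have "vec.dim (perp x) < vec.dim (UNIV :: (rat^'n) set)"
    by (rule vec.dim_psubset)
  then have 2: "vec.dim (perp x) < CARD('n)"
    by (simp only: vec_dim_card)
  have "rank A \<le> vec.dim (perp x \<inter> perp z)"
    unfolding row_rank_def_gen using rows x z by (intro vec.dim_subset) auto
  then show False
    using 1 2 corank by (simp add: corank_def)
qed

lemma symmetric_form_root_form:
  assumes "symmetrizer D A"
  shows "symmetric_form (root_form D A)"
proof
  have S: "scaled D A $ i $ j = scaled D A $ j $ i" for i j
    using assms by (auto simp: symmetrizer_def transpose_def vec_eq_iff)
  show "root_form D A x y = root_form D A y x" for x y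
    unfolding root_form_def by (subst sum.swap, intro sum.cong refl) (simp_all add: S mult_ac)
  show "root_form D A (x + y) z = root_form D A x z + root_form D A y z" for x y z
    by (simp add: root_form_def algebra_simps sum.distrib)
  show "root_form D A (c *s x) y = c * root_form D A x y" for c x y
    by (simp add: root_form_def sum_distrib_left mult_ac)
qed

lemma root_form_nonneg:
  "positive_semidefinite (scaled D A) \<Longrightarrow> root_form D A x x \<ge> 0"
  unfolding positive_semidefinite_def root_form_def by blast

lemma root_form_supported_off:
  fixes A :: "rat^'n^'n" and D :: "'n::finite \<Rightarrow> nat"
  assumes "x $ d = 0"
  shows "root_form D A x x = (\<Sum>i\<in>UNIV - {d}. \<Sum>j\<in>UNIV - {d}. x $ i * scaled D A $ i $ j * x $ j)"
proof -
  have "(\<Sum>j\<in>UNIV. x $ i * scaled D A $ i $ j * x $ j)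
      = (\<Sum>j\<in>UNIV - {d}. x $ i * scaled D A $ i $ j * x $ j)" for i
    using assms by (intro sum.mono_neutral_right) auto
  then show ?thesis
    unfolding root_form_def using assms by (intro sum.mono_neutral_cong_right) auto
qed

lemma positive_definite_off_vertex_iff:
  fixes A :: "rat^'n^'n" and D :: "'n::finite \<Rightarrow> nat"
  shows "positive_definite_on (UNIV - {d}) (scaled D A) \<longleftrightarrow>
     (\<forall>x. x \<noteq> 0 \<longrightarrow> x $ d = 0 \<longrightarrow> root_form D A x x > 0)"
proof (intro iffI allI impI)
  fix x :: "rat^'n"
  assume pd: "positive_definite_on (UNIV - {d}) (scaled D A)" and x: "x \<noteq> 0" "x $ d = 0"
  then have "\<exists>i\<in>UNIV - {d}. x $ i \<noteq> 0"
    by (metis DiffI UNIV_I singletonD vec_eq_iff zero_index)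
  with pd show "root_form D A x x > 0"
    unfolding root_form_supported_off[where x = x, OF x(2)] positive_definite_on_def by blast
next
  assume pd: "\<forall>x. x \<noteq> 0 \<longrightarrow> x $ d = 0 \<longrightarrow> root_form D A x x > 0"
  show "positive_definite_on (UNIV - {d}) (scaled D A)"
    unfolding positive_definite_on_def
  proof (intro allI impI)
    fix x :: "'n \<Rightarrow> rat"
    assume "\<exists>i\<in>UNIV - {d}. x i \<noteq> 0"
    then obtain i where i: "i \<noteq> d" "x i \<noteq> 0" by auto
    let ?x = "(\<chi> i. if i = d then 0 else x i) :: rat^'n"
    have "?x $ i \<noteq> 0" using i by simp
    then have "?x \<noteq> 0" by (metis zero_index)
    then have "root_form D A ?x ?x > 0"
      using pd by simp
    then show "0 < (\<Sum>i\<in>UNIV - {d}. \<Sum>j\<in>UNIV - {d}. x i * scaled D A $ i $ j * x j)"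
      by (subst (asm) root_form_supported_off[of _ d]) simp_all
  qed
qed

lemma exists_vertex_with_definite_complement:
  fixes A :: "rat^'n^'n"
  assumes symm: "symmetrizer D A" and psd: "positive_semidefinite (scaled D A)"
    and corank: "corank A \<le> 1"
  shows "\<exists>d. positive_definite_on (UNIV - {d}) (scaled D A)"
proof -
  interpret symmetric_form "root_form D A"
    using symm by (rule symmetric_form_root_form)
  have ker: "A *v x = 0" if "root_form D A x x = 0" for x
  proof -
    have "(A *v x) $ i = 0" for i
    proof -
      have "0 = root_form D A (axis i 1) x"
        using isotropic_in_radical[OF root_form_nonneg[OF psd] that] sym by metis
      also have "\<dots> = (\<Sum>k\<in>UNIV. if k = i then \<Sum>j\<in>UNIV. scaled D A $ k $ j * x $ j else 0)"
        unfolding root_form_def by (intro sum.cong) (auto simp: axis_def)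
      also have "\<dots> = of_nat (D i) * (A *v x) $ i"
        by (simp add: scaled_def matrix_vector_mult_def sum_distrib_left mult_ac)
      finally show ?thesis
        using symm by (simp add: symmetrizer_def) (metis less_irrefl)
    qed
    then show ?thesis by (simp add: vec_eq_iff)
  qed
  \<comment> \<open>Any vertex in the support of a generator of the radical will do.\<close>
  obtain d where d: "\<And>x. A *v x = 0 \<Longrightarrow> x $ d = 0 \<Longrightarrow> x = 0"
  proof (cases "\<exists>z. A *v z = 0 \<and> z \<noteq> 0")
    case True
    then obtain z d where "A *v z = 0" "z $ d \<noteq> 0"
      by (auto simp: vec_eq_iff)
    then show ?thesis
      using kernel_vector_determined_by_coordinate[OF corank] that by blast
  next
    case False
    then show ?thesis using that by blast
  qed
  have "root_form D A x x > 0" if "x \<noteq> 0" "x $ d = 0" for x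
    using ker d that root_form_nonneg[OF psd, of x] by (metis order_less_le)
  then show ?thesis
    unfolding positive_definite_off_vertex_iff by blast
qed

section \<open>Braid-equivalence\<close>

text \<open>Reflecting a set of vertices one at a time is the same as reflecting them simultaneously, as long
  as \<open>\<Delta> a\<close> itself is left alone.\<close>

lemma braid_reachable_partial_APR:
  assumes "braid_reachable F \<Delta>\<^sub>0 \<Delta>" "finite S" "a \<notin> S"
  shows "braid_reachable F \<Delta>\<^sub>0 (\<lambda>i. if i \<in> S then reflection F (\<Delta> a) (\<Delta> i) else \<Delta> i)"
  using assms(2,3)
proof (induction S rule: finite_induct)
  case empty
  then show ?case using assms(1) by simp
next
  case (insert b S)
  let ?\<Gamma> = "\<lambda>i. if i \<in> S then reflection F (\<Delta> a) (\<Delta> i) else \<Delta> i"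
  have "braid_reachable F \<Delta>\<^sub>0 (braid_transform F a b ?\<Gamma>)"
    using insert by (intro braid_reachable.braid) auto
  also have "braid_transform F a b ?\<Gamma> =
      (\<lambda>i. if i \<in> insert b S then reflection F (\<Delta> a) (\<Delta> i) else \<Delta> i)"
    using insert by (auto simp: braid_transform_def)
  finally show ?case .
qed

lemma braid_reachable_APR_transform:
  fixes F :: "rat^'n::finite \<Rightarrow> rat^'n \<Rightarrow> rat"
  assumes "braid_reachable F \<Delta>\<^sub>0 \<Delta>"
  shows "braid_reachable F \<Delta>\<^sub>0 (APR_transform F a \<Delta>)"
proof -
  let ?N = "APR_neighbours (structural_matrix F \<Delta>) a"
  \<comment> \<open>The vector at \<open>a\<close> is negated last, when it is no longer needed as a mirror for the others.\<close>
  let ?\<Gamma> = "\<lambda>i. if i \<in> ?N - {a} then reflection F (\<Delta> a) (\<Delta> i) else \<Delta> i"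
  have "braid_reachable F \<Delta>\<^sub>0 (braid_transform F a a ?\<Gamma>)"
    by (intro braid_reachable.braid braid_reachable_partial_APR[OF assms]) auto
  also have "braid_transform F a a ?\<Gamma> = APR_transform F a \<Delta>"
    by (auto simp: braid_transform_def APR_transform_def APR_neighbours_def)
  finally show ?thesis .
qed

lemma braid_reachable_fold_APR:
  fixes F :: "rat^'n::finite \<Rightarrow> rat^'n \<Rightarrow> rat"
  assumes "braid_reachable F \<Delta>\<^sub>0 \<Delta>"
  shows "braid_reachable F \<Delta>\<^sub>0 (fold (APR_transform F) as \<Delta>)"
  using assms by (induction as arbitrary: \<Delta>) (simp_all add: braid_reachable_APR_transform)

context symmetric_form
begin

lemma APR_transform_norm:
  assumes "F (\<Delta> a) (\<Delta> a) \<noteq> 0"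
  shows "F (APR_transform F a \<Delta> i) (APR_transform F a \<Delta> i) = F (\<Delta> i) (\<Delta> i)"
  using reflection_preserves_form[OF assms] by (simp add: APR_transform_def)

lemma fold_APR_norm:
  assumes "\<And>i. F (\<Delta> i) (\<Delta> i) \<noteq> 0"
  shows "F (fold (APR_transform F) as \<Delta> i) (fold (APR_transform F) as \<Delta> i) = F (\<Delta> i) (\<Delta> i)"
  using assms by (induction as arbitrary: \<Delta>) (simp_all add: APR_transform_norm)

end

text \<open>The norms \<open>2 * D i\<close> do not change, so multiplying row \<open>i\<close> of a structural matrix by \<open>D i\<close> gives back
  the Gram matrix of the current basis.\<close>

lemma symmetrizer_APR_sequence:
  assumes gim: "gen_intersection_matrix A" and symm: "symmetrizer D A"
  shows "symmetrizer D (APR_sequence D A as)"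
proof -
  interpret symmetric_form "root_form D A"
    using symm by (rule symmetric_form_root_form)
  have D: "D i > 0" for i
    using symm by (simp add: symmetrizer_def)
  have norm0: "root_form D A (root_basis i) (root_basis i) = 2 * of_nat (D i)" for i
    using gim by (simp add: root_form_root_basis scaled_def gen_intersection_matrix_def)
  let ?\<Delta> = "fold (APR_transform (root_form D A)) as root_basis"
  have norm: "root_form D A (?\<Delta> i) (?\<Delta> i) = 2 * of_nat (D i)" for i
    using D by (subst fold_APR_norm) (simp_all add: norm0 less_imp_neq[symmetric])
  have "scaled D (APR_sequence D A as) $ i $ j = root_form D A (?\<Delta> i) (?\<Delta> j)" for i j
    using D[of i] by (simp add: scaled_def APR_sequence_def structural_matrix_def norm)
  then have "transpose (scaled D (APR_sequence D A as)) = scaled D (APR_sequence D A as)"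
    by (simp add: transpose_def vec_eq_iff sym)
  then show ?thesis
    using symm by (simp add: symmetrizer_def)
qed

section \<open>Reduction to a generalized Cartan matrix\<close>

lemma admissible_root_basis:
  assumes gim: "gen_intersection_matrix A" and symm: "symmetrizer D A"
  shows "admissible (root_form D A) (\<lambda>i. 2 * of_nat (D i)) d root_basis"
proof -
  have "independent_family (root_basis :: 'a \<Rightarrow> rat^'a)"
  proof -
    have "(\<Sum>i\<in>UNIV. x i *s (root_basis i :: rat^'a)) = (\<chi> i. x i)" for x
      using basis_expansion[of "\<chi> i. x i"] by (simp add: root_basis_def)
    then show ?thesis
      by (simp add: independent_family_def vec_eq_iff)
  qed
  moreover have "root_form D A (root_basis i) (root_basis i) = 2 * of_nat (D i)" for i
    using gim by (simp add: root_form_root_basis scaled_def gen_intersection_matrix_def)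
  ultimately show ?thesis
    unfolding admissible_def structural_matrix_root_basis[OF gim symm]
    using gim by (auto simp: gen_intersection_matrix_def root_basis_def axis_def)
qed

theorem theorem2p10:
  fixes A :: "rat^'n^'n" and D :: "'n::finite \<Rightarrow> nat"
  assumes "gen_intersection_matrix A"
    and "symmetrizer D A"
    and "positive_semidefinite (scaled D A)"
    and "corank A \<le> 1"
  shows "(\<forall>d. positive_definite_on (UNIV - {d}) (scaled D A) \<longrightarrow>
            (\<exists>as. set as \<subseteq> UNIV - {d} \<and> gen_Cartan_matrix (APR_sequence D A as)))
       \<and> (\<exists>A'. gen_Cartan_matrix A' \<and> braid_equivalent A A')"
proof -
  interpret symmetric_form "root_form D A"
    using assms(2) by (rule symmetric_form_root_form)
  have D: "2 * of_nat (D i) > (0 :: rat)" for i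
    using assms(2) by (simp add: symmetrizer_def)
  have APR: "\<exists>as. set as \<subseteq> UNIV - {d} \<and> gen_Cartan_matrix (APR_sequence D A as)"
    if pd: "positive_definite_on (UNIV - {d}) (scaled D A)" for d
    unfolding APR_sequence_def
    using pd root_form_nonneg[OF assms(3)] D admissible_root_basis[OF assms(1,2)]
    by (intro APR_reaches_Cartan) (auto simp: positive_definite_off_vertex_iff)
  moreover obtain d where "positive_definite_on (UNIV - {d}) (scaled D A)"
    using exists_vertex_with_definite_complement[OF assms(2-4)] by blast
  then obtain as where as: "gen_Cartan_matrix (APR_sequence D A as)"
    using APR by blast
  have "braid_obtained A (APR_sequence D A as)"
    unfolding braid_obtained_def APR_sequence_def
    using assms(2) braid_reachable_fold_APR[OF braid_reachable.refl] by blast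
  moreover have "SIM A" "SIM (APR_sequence D A as)"
    using assms(1,2) as symmetrizer_APR_sequence[OF assms(1,2)]
    by (auto simp: SIM_def gen_Cartan_matrix_def)
  ultimately show ?thesis
    using as by (auto simp: braid_equivalent_def)
qed

end
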